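(* Let $X$ be the geometric realization of the graph with vertex set $$V=\{a_1,a_2,b_1,b_2,c,d_1,d_2,d_3,e_1,e_2,e_3,q\}$$ and edge set $$E=\{a_1a_2,\ a_2c,\ b_1b_2,\ b_2c,\ cd_1,\ ce_1,\ d_1d_2,\ d_2d_3,\ d_3q,\ e_1e_2,\ e_2e_3,\ e_3q\},$$ and let $f:X\to[0,\infty)$ be the function that is linear on each edge and takes the vertex values $f(a_1)=f(b_1)=5$, $f(c)=f(q)=2$, and $f(a_2)=f(b_2)=f(d_i)=f(e_i)=1$ for $i=1,2,3$. Then the unimodal $\tfrac12$-category of $f$ is $$\mathbf{ucat}^{1/2}(f)=\mathbf{ucat}(\sqrt f)=3.$$
   Context: A continuous function $u:X\to[0,\infty)$ on a topological space is unimodal if there is $M>0$ such that the superlevel set $u^{-1}[c,\infty)$ is contractible for $0<c\le M$ and empty for $c>M$. For $p\in(0,\infty)$, the unimodal $p$-category $\mathbf{ucat}^p(f)$ of $f:X\to[0,\infty)$ is the minimum number $n$ of unimodal functions $u_1,\dots,u_n:X\to[0,\infty)$ such that pointwise $f=\left(\sum_{i=1}^n u_i^p\right)^{1/p}$; $\mathbf{ucat}=\mathbf{ucat}^1$. Here $xy$ is shorthand for the edge $\{x,y\}$, and vertices of the graph are identified with their corresponding points in $X$. *)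

theory Defs
  imports "HOL-Analysis.Analysis"
begin

definition superlevel :: "'a topology \<Rightarrow> ('a \<Rightarrow> real) \<Rightarrow> real \<Rightarrow> 'a set" where
  "superlevel X u c = {x \<in> topspace X. c \<le> u x}"

text \<open>
  A contractible space is homotopy equivalent to a point, hence nonempty. The library predicate
  \<^const>\<open>contractible_space\<close> also holds for the empty space, so nonemptiness is required separately.
\<close>

definition unimodal :: "'a topology \<Rightarrow> ('a \<Rightarrow> real) \<Rightarrow> bool" where
  "unimodal X u \<longleftrightarrow>
     continuous_map X (top_of_set {0..}) u \<and>
     (\<exists>M>0. (\<forall>c. 0 < c \<and> c \<le> M \<longrightarrow>
               superlevel X u c \<noteq> {} \<and>
               contractible_space (subtopology X (superlevel X u c))) \<and>
            (\<forall>c>M. superlevel X u c = {}))"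

text \<open>
  Meaningful for \<open>p > 0\<close>; note that \<open>0 powr p = 0\<close>. The infimum in \<^typ>\<open>enat\<close> is attained
  whenever some decomposition exists, and is \<open>\<infinity>\<close> otherwise.
\<close>

definition ucat_pow :: "real \<Rightarrow> 'a topology \<Rightarrow> ('a \<Rightarrow> real) \<Rightarrow> enat" where
  "ucat_pow p X f = Inf {enat n | n. \<exists>u :: nat \<Rightarrow> 'a \<Rightarrow> real.
     (\<forall>i<n. unimodal X (u i)) \<and>
     (\<forall>x\<in>topspace X. f x = (\<Sum>i<n. u i x powr p) powr (1 / p))}"

definition ucat :: "'a topology \<Rightarrow> ('a \<Rightarrow> real) \<Rightarrow> enat" where
  "ucat = ucat_pow 1"

text \<open>
  Geometric realization of a finite graph with vertex set \<open>UNIV :: 'v set\<close>: vertices are the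
  standard basis vectors of \<open>real ^ 'v\<close> and edges are the segments they span. As the graph is
  finite, the subspace topology is the usual topology of the realization.
\<close>

definition vertex_point :: "'v::finite \<Rightarrow> real ^ 'v" where
  "vertex_point v = axis v 1"

definition realization :: "'v::finite set set \<Rightarrow> (real ^ 'v) set" where
  "realization E = range vertex_point \<union> (\<Union>e\<in>E. convex hull (vertex_point ` e))"

definition linear_on_edges :: "'v::finite set set \<Rightarrow> (real ^ 'v \<Rightarrow> real) \<Rightarrow> bool" where
  "linear_on_edges E f \<longleftrightarrow>
     (\<forall>v w t. {v, w} \<in> E \<and> 0 \<le> t \<and> t \<le> 1 \<longrightarrow>
        f ((1 - t) *\<^sub>R vertex_point v + t *\<^sub>R vertex_point w) =
          (1 - t) * f (vertex_point v) + t * f (vertex_point w))"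

datatype vertex = A1 | A2 | B1 | B2 | C | D1 | D2 | D3 | E1 | E2 | E3 | Q

lemma UNIV_vertex: "(UNIV :: vertex set) = {A1, A2, B1, B2, C, D1, D2, D3, E1, E2, E3, Q}"
proof -
  have "v \<in> {A1, A2, B1, B2, C, D1, D2, D3, E1, E2, E3, Q}" for v :: vertex
    by (cases v) simp_all
  then show ?thesis by blast
qed

instance vertex :: finite
  by standard (simp add: UNIV_vertex)

definition edges :: "vertex set set" where
  "edges = {{A1, A2}, {A2, C}, {B1, B2}, {B2, C}, {C, D1}, {C, E1},
            {D1, D2}, {D2, D3}, {D3, Q}, {E1, E2}, {E2, E3}, {E3, Q}}"

end

theory Submission
  imports Defs "HOL-Complex_Analysis.Winding_Numbers"
begin

text \<open>
  Since \<open>u\<close> and \<open>u powr p\<close> have the same superlevel sets up to a change of level, the unimodal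
  1/2-category of \<open>f\<close> is the unimodal category of \<open>h = sqrt f\<close> (\<open>ucat_pow_eq_ucat\<close>). In
  barycentric coordinates \<open>f = 1 + 4 A1 + 4 B1 + C + Q\<close> on the graph.

  The graph consists of one circuit through \<open>C\<close> and \<open>Q\<close> and two arms hanging from \<open>C\<close>. The lower
  bound rests on two facts about a unimodal summand \<open>u\<close>. A subset of the graph that contains the
  circuit is not contractible, because the graph maps to the boundary of a square in such a way that
  the circuit becomes a loop of winding number 1; hence no superlevel set of \<open>u\<close> at a positive
  level contains the circuit, and \<open>u\<close> has a zero on it (\<open>unimodal_zero_on_circuit\<close>). Moreover
  superlevel sets are connected, so the smaller of the values of \<open>u\<close> at two points is at most its
  value at any vertex separating them (\<open>unimodal_min_le_cut_vertex\<close>). As \<open>h\<close> drops from \<open>A1\<close> to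
  \<open>A2\<close>, some summand \<open>i\<close> drops there; by the cut vertex inequality at \<open>A2\<close> it is then at most its
  value at \<open>A2\<close> outside the outer edge of that arm. Likewise some \<open>j\<close> drops from \<open>B1\<close> to \<open>B2\<close>, and
  comparison of the two shows \<open>i \<noteq> j\<close>. On the circuit both \<open>u i\<close> and \<open>u j\<close> are maximal at \<open>C\<close>, by
  the cut vertex inequality at \<open>C\<close>. If these were the only summands, then where one of them
  vanishes on the circuit the other would equal \<open>h \<ge> 1\<close>; so both would be at least 1 at \<open>C\<close>,
  against \<open>h(C) = sqrt 2 < 2\<close>.

  For the upper bound, three explicit summands are given, with peaks at \<open>A1\<close>, \<open>B1\<close> and \<open>Q\<close>. Each of
  them decreases along the edges of a tree rooted at its peak and vanishes off that tree. Every
  nonempty superlevel set is then obtained by attaching segments at single points, starting from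
  the root, so it is an absolute retract and in particular contractible
  (\<open>unimodal_descending_tree\<close>).
\<close>

section \<open>Barycentric coordinates on a graph\<close>

definition cell :: "'v::finite set \<Rightarrow> (real ^ 'v) set" where
  "cell e = convex hull (vertex_point ` e)"

text \<open>
  The coordinates of a point of the realization are its barycentric coordinates, so this linear map
  interpolates the vertex values \<open>g\<close> on every cell. It serves for the function of the theorem, for
  the signs that detect a cut vertex, and for the map of the graph to a square.
\<close>

definition extend :: "('v::finite \<Rightarrow> 'b::real_vector) \<Rightarrow> real ^ 'v \<Rightarrow> 'b" where
  "extend g x = (\<Sum>v\<in>UNIV. x $ v *\<^sub>R g v)"

lemma linear_extend: "linear (extend g)"
  by (rule linearI)
    (simp_all add: extend_def scaleR_left_distrib sum.distrib scaleR_sum_right)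

lemma continuous_on_extend:
  fixes g :: "'v::finite \<Rightarrow> 'b::real_normed_vector"
  shows "continuous_on S (extend g)"
  by (simp add: linear_continuous_on linear_conv_bounded_linear [symmetric] linear_extend)

lemma vertex_point_nth: "vertex_point v $ w = (if w = v then 1 else 0)"
  by (simp add: vertex_point_def axis_def)

lemma extend_vertex_point [simp]: "extend g (vertex_point v) = g v"
  by (simp add: extend_def vertex_point_nth if_distrib [of "\<lambda>t. t *\<^sub>R _"] cong: if_cong)

lemma mem_cell_iff:
  "x \<in> cell e \<longleftrightarrow> (\<forall>v. 0 \<le> x $ v) \<and> (\<Sum>v\<in>UNIV. x $ v) = 1 \<and> (\<forall>v. v \<notin> e \<longrightarrow> x $ v = 0)"
  (is "_ \<longleftrightarrow> ?P x")
proof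
  have "convex {x. ?P x}"
  proof (rule convexI, clarsimp)
    fix x y :: "real ^ 'a" and s t :: real
    assume "sum (($) x) UNIV = 1" "sum (($) y) UNIV = 1" "s + t = 1"
    then have "s * (\<Sum>v\<in>UNIV. x $ v) + t * (\<Sum>v\<in>UNIV. y $ v) = 1" by simp
    then show "(\<Sum>v\<in>UNIV. s * x $ v + t * y $ v) = 1"
      by (simp only: sum.distrib sum_distrib_left)
  qed
  moreover have "vertex_point ` e \<subseteq> {x. ?P x}"
    by (auto simp: vertex_point_nth)
  ultimately have "cell e \<subseteq> {x. ?P x}"
    unfolding cell_def by (rule hull_minimal [rotated])
  then show "?P x" if "x \<in> cell e"
    using that by blast
next
  assume x: "?P x"
  have "x = (\<Sum>v\<in>UNIV. x $ v *\<^sub>R vertex_point v)"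
    by (simp add: vec_eq_iff vertex_point_nth if_distrib [of "(*) _"] cong: if_cong)
  also have "\<dots> = (\<Sum>v\<in>e. x $ v *\<^sub>R vertex_point v)"
    by (rule sum.mono_neutral_right) (use x in auto)
  also have "\<dots> \<in> cell e"
    unfolding cell_def
  proof (rule convex_sum)
    show "(\<Sum>v\<in>e. x $ v) = 1"
      using x sum.mono_neutral_right [of UNIV e "\<lambda>v. x $ v"] by auto
  qed (use x in \<open>auto intro: hull_inc\<close>)
  finally show "x \<in> cell e" .
qed

lemma convex_cell: "convex (cell e)"
  by (simp add: cell_def)

lemma closed_cell: "closed (cell e)"
  by (simp add: cell_def compact_imp_closed finite_imp_compact_convex_hull)

lemma vertex_point_mem_cell [intro]: "v \<in> e \<Longrightarrow> vertex_point v \<in> cell e"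
  by (simp add: cell_def hull_inc)

lemma cell_singleton [simp]: "cell {v} = {vertex_point v}"
  by (simp add: cell_def)

lemma realization_cells: "realization E = range vertex_point \<union> (\<Union>e\<in>E. cell e)"
  by (simp add: realization_def cell_def)

lemma mem_edge_iff:
  assumes "v \<noteq> w"
  shows "x \<in> cell {v, w} \<longleftrightarrow>
    0 \<le> x $ v \<and> 0 \<le> x $ w \<and> x $ v + x $ w = 1 \<and> (\<forall>z. z \<noteq> v \<and> z \<noteq> w \<longrightarrow> x $ z = 0)"
proof -
  have "(\<Sum>z\<in>UNIV. x $ z) = x $ v + x $ w" if "\<forall>z. z \<noteq> v \<and> z \<noteq> w \<longrightarrow> x $ z = 0"
    using assms that sum.mono_neutral_right [of UNIV "{v, w}" "\<lambda>z. x $ z"] by auto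
  then show ?thesis
    unfolding mem_cell_iff by auto (metis order_refl)
qed

lemma cell_nth_le:
  assumes "x \<in> cell e"
  shows "x $ v \<le> vertex_point v $ v"
proof -
  have "x $ v \<le> (\<Sum>w\<in>UNIV. x $ w)"
    using assms by (intro member_le_sum) (auto simp: mem_cell_iff)
  with assms show ?thesis by (simp add: mem_cell_iff vertex_point_nth)
qed

lemma extend_edge:
  assumes "x \<in> cell {v, w}" "v \<noteq> w"
  shows "extend g x = x $ v *\<^sub>R g v + x $ w *\<^sub>R g w"
proof -
  have "extend g x = (\<Sum>z\<in>{v, w}. x $ z *\<^sub>R g z)"
    unfolding extend_def using assms
    by (intro sum.mono_neutral_right) (auto simp: mem_edge_iff)
  with assms(2) show ?thesis by simp
qed

lemma linear_on_edges_extend: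
  assumes "linear_on_edges E f" "{v, w} \<in> E" "v \<noteq> w" "x \<in> cell {v, w}"
  shows "f x = extend (\<lambda>z. f (vertex_point z)) x"
proof -
  have "x = (1 - x $ w) *\<^sub>R vertex_point v + x $ w *\<^sub>R vertex_point w"
    using assms(3,4) by (auto simp: mem_edge_iff vec_eq_iff vertex_point_nth)
  moreover have "0 \<le> x $ w" "x $ w \<le> 1" "x $ v = 1 - x $ w"
    using assms(3,4) by (auto simp: mem_edge_iff)
  ultimately show ?thesis
    using assms unfolding linear_on_edges_def by (metis extend_edge real_scaleR_def)
qed

section \<open>Cut vertices\<close>

text \<open>
  Give the vertices of \<open>W\<close> the weight 1, the cut vertex \<open>k\<close> the weight 0, and all others the weight
  -1. No edge carries weights of both signs, so the interpolated weight vanishes on the graph only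
  at \<open>k\<close>, and the intermediate value theorem on the connected set \<open>S\<close> yields that point.
\<close>

lemma connected_contains_cut_vertex:
  fixes W :: "'v::finite set"
  assumes S: "connected S" "S \<subseteq> (\<Union>e\<in>E. cell e)"
    and cut: "k \<notin> W" "\<And>e. e \<in> E \<Longrightarrow> e \<subseteq> insert k W \<or> e \<inter> W = {}"
    and x: "x \<in> S" "x \<in> cell e" "e \<subseteq> insert k W"
    and y: "y \<in> S" "y \<in> cell e'" "e' \<inter> W = {}"
  shows "vertex_point k \<in> S"
proof -
  define s :: "'v \<Rightarrow> real" where "s = (\<lambda>v. if v = k then 0 else if v \<in> W then 1 else - 1)"
  have "connected (extend s ` S)"
    using S(1) continuous_on_extend by (rule connected_continuous_image [rotated])
  moreover have "0 \<le> extend s x"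
    unfolding extend_def
    by (rule sum_nonneg) (use x in \<open>auto simp: s_def mem_cell_iff\<close>)
  moreover have "extend s y \<le> 0"
    unfolding extend_def
    by (rule sum_nonpos) (use y in \<open>auto simp: s_def mem_cell_iff\<close>)
  ultimately have "0 \<in> extend s ` S"
    using x(1) y(1) by (meson connectedD_interval imageI)
  then obtain z where z: "z \<in> S" "extend s z = 0" by force
  then obtain d where d: "d \<in> E" "z \<in> cell d" using S(2) by blast
  have zero: "z $ v = 0" if "v \<noteq> k" for v
  proof (cases "d \<subseteq> insert k W")
    case True
    have "(\<Sum>v\<in>UNIV. z $ v * s v) = 0" using z(2) by (simp add: extend_def)
    moreover have "0 \<le> z $ v * s v" for v
      using True d(2) by (auto simp: s_def mem_cell_iff)
    ultimately have "z $ v * s v = 0" by (simp add: sum_nonneg_eq_0_iff)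
    with that show ?thesis by (auto simp: s_def split: if_splits)
  next
    case False
    then have "d \<inter> W = {}" using cut(2) d(1) by blast
    have "(\<Sum>v\<in>UNIV. - (z $ v * s v)) = 0" using z(2) by (simp add: extend_def sum_negf)
    moreover have "0 \<le> - (z $ v * s v)" for v
      using \<open>d \<inter> W = {}\<close> d(2) by (auto simp: s_def mem_cell_iff)
    ultimately have "z $ v * s v = 0"
      by (metis (no_types, lifting) UNIV_I finite neg_equal_0_iff_equal sum_nonneg_eq_0_iff)
    with that show ?thesis by (auto simp: s_def split: if_splits)
  qed
  have "(\<Sum>v\<in>UNIV. z $ v) = 1" using d(2) by (simp add: mem_cell_iff)
  then have "z $ k = 1"
    using zero sum.mono_neutral_right [of UNIV "{k}" "\<lambda>v. z $ v"] by auto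
  then have "z = vertex_point k"
    using zero by (auto simp: vec_eq_iff vertex_point_nth)
  with z(1) show ?thesis by simp
qed

lemma unimodal_continuous_on:
  "unimodal (top_of_set K) u \<Longrightarrow> continuous_on K u"
  by (auto simp: unimodal_def continuous_map_in_subtopology)

lemma unimodal_nonneg:
  "unimodal X u \<Longrightarrow> x \<in> topspace X \<Longrightarrow> 0 \<le> u x"
  by (auto simp: unimodal_def continuous_map_in_subtopology image_subset_iff Pi_iff)

lemma unimodal_superlevel_contractible:
  assumes "unimodal (top_of_set K) u" "x \<in> K" "0 < c" "c \<le> u x"
  shows "contractible {y \<in> K. c \<le> u y}"
proof -
  obtain M where M: "\<And>c. 0 < c \<Longrightarrow> c \<le> M \<Longrightarrow>
      contractible_space (subtopology (top_of_set K) (superlevel (top_of_set K) u c))"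
    and empty: "\<And>c. c > M \<Longrightarrow> superlevel (top_of_set K) u c = {}"
    using assms(1) unfolding unimodal_def by blast
  have "x \<in> superlevel (top_of_set K) u c"
    using assms by (simp add: superlevel_def)
  then have "c \<le> M" using empty by (metis empty_iff not_le)
  moreover have "K \<inter> superlevel (top_of_set K) u c = {y \<in> K. c \<le> u y}"
    by (auto simp: superlevel_def)
  ultimately show ?thesis
    using M [OF \<open>0 < c\<close>] by (simp add: subtopology_subtopology)
qed

text \<open>
  The superlevel set at the smaller of the two values is connected and contains both points, hence
  also the vertex separating them.
\<close>

lemma unimodal_min_le_cut_vertex:
  fixes W :: "'v::finite set"
  assumes u: "unimodal (top_of_set (realization E)) u"
    and E: "realization E = (\<Union>e\<in>E. cell e)"
    and cut: "k \<notin> W" "\<forall>e\<in>E. e \<subseteq> insert k W \<or> e \<inter> W = {}"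
    and x: "x \<in> cell e" "e \<in> E" "e \<subseteq> insert k W"
    and y: "y \<in> cell e'" "e' \<in> E" "e' \<inter> W = {}"
  shows "min (u x) (u y) \<le> u (vertex_point k)"
proof -
  let ?m = "min (u x) (u y)"
  have mem: "x \<in> realization E" "y \<in> realization E" "vertex_point k \<in> realization E"
    using x y by (auto simp: realization_cells)
  show ?thesis
  proof (cases "0 < ?m")
    case True
    have "contractible {z \<in> realization E. ?m \<le> u z}"
      using unimodal_superlevel_contractible [OF u mem(1) True] by simp
    then have "vertex_point k \<in> {z \<in> realization E. ?m \<le> u z}"
      using cut x y mem
      by (intro connected_contains_cut_vertex [where E = E and W = W and x = x and y = y
            and e = e and e' = e'] contractible_imp_connected) (auto simp: E)
    then show ?thesis by simp
  next
    case False
    then show ?thesis using unimodal_nonneg [OF u, of "vertex_point k"] mem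
      by (auto simp: min_def split: if_splits)
  qed
qed

section \<open>Functions descending along a tree\<close>

text \<open>
  A tree with root \<open>r\<close>, vertex set \<open>V\<close> and edge set \<open>F\<close>, built by attaching edges \<open>{v, w}\<close> at a
  vertex \<open>v\<close> already present, along each of which \<open>u\<close> decreases (weakly) on the way from \<open>v\<close> to
  the new vertex \<open>w\<close>.
\<close>

inductive descending_tree ::
  "(real ^ 'v \<Rightarrow> real) \<Rightarrow> 'v::finite \<Rightarrow> 'v set \<Rightarrow> 'v set set \<Rightarrow> bool" for u r where
  root: "descending_tree u r {r} {}"
| grow: "descending_tree u r V F \<Longrightarrow> v \<in> V \<Longrightarrow> w \<notin> V \<Longrightarrow>
    \<forall>x\<in>cell {v, w}. \<forall>y\<in>cell {v, w}. x $ v \<le> y $ v \<longrightarrow> u x \<le> u y \<Longrightarrow>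
    descending_tree u r (insert w V) (insert {v, w} F)"

abbreviation tree_region :: "'v::finite \<Rightarrow> 'v set set \<Rightarrow> (real ^ 'v) set" where
  "tree_region r F \<equiv> cell {r} \<union> (\<Union>e\<in>F. cell e)"

lemma descending_tree_vertices:
  assumes "descending_tree u r V F"
  shows "r \<in> V" "\<Union>F \<subseteq> V" "v \<in> V \<Longrightarrow> vertex_point v \<in> tree_region r F"
  using assms
proof (induction)
  case (grow V F v' w)
  { case 1 then show ?case using grow by simp }
  { case 2 then show ?case using grow by auto }
  { case 3 then show ?case using grow by auto }
qed auto

lemma descending_tree_le_root:
  assumes "descending_tree u r V F" "x \<in> tree_region r F"
  shows "u x \<le> u (vertex_point r)"
  using assms
proof (induction arbitrary: x)
  case (grow V F v w)
  have "u x \<le> u (vertex_point v)" if x: "x \<in> cell {v, w}"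
  proof -
    have "x $ v \<le> vertex_point v $ v"
      using x by (rule cell_nth_le)
    then show ?thesis using grow.hyps(4) x by auto
  qed
  moreover have "u (vertex_point v) \<le> u (vertex_point r)"
    using grow.IH descending_tree_vertices(3) [OF grow.hyps(1,2)] by blast
  ultimately show ?case using grow.IH grow.prems by fastforce
qed simp

text \<open>
  Monotonicity along a new edge \<open>{v, w}\<close> makes the superlevel set in its cell a segment that
  contains \<open>v\<close>, unless it is empty. It meets the old region only in \<open>v\<close>, since \<open>w\<close> is new, and the
  union of two closed absolute retracts whose intersection is an absolute retract is again one.
  Contractibility itself would not be preserved by such unions in general, which is why the
  induction is on absolute retracts.
\<close>

lemma descending_tree_superlevel_AR:
  assumes "descending_tree u r V F" "continuous_on UNIV u" "c \<le> u (vertex_point r)"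
  shows "closed {x \<in> tree_region r F. c \<le> u x} \<and> AR {x \<in> tree_region r F. c \<le> u x}"
  using assms(1)
proof induction
  case root
  have "{x \<in> tree_region r {}. c \<le> u x} = {vertex_point r}"
    using assms(3) by auto
  then show ?case by (simp add: convex_imp_AR)
next
  case (grow V F v w)
  have vw: "v \<noteq> w" using grow.hyps by blast
  let ?T = "{x \<in> tree_region r F. c \<le> u x}" and ?S = "{x \<in> cell {v, w}. c \<le> u x}"
  have eq: "{x \<in> tree_region r (insert {v, w} F). c \<le> u x} = ?T \<union> ?S"
    by auto
  have "closed (cell {v, w} \<inter> u -` {c..})"
    using assms(2) closed_cell by (intro closed_Int closed_vimage) auto
  moreover have "cell {v, w} \<inter> u -` {c..} = ?S" by auto
  ultimately have clS: "closed ?S" by simp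
  have conv: "convex ?S"
    unfolding convex_alt
  proof clarify
    fix x y :: "real ^ 'a" and t :: real
    assume xy: "x \<in> cell {v, w}" "y \<in> cell {v, w}" "c \<le> u x" "c \<le> u y" and t: "0 \<le> t" "t \<le> 1"
    let ?z = "(1 - t) *\<^sub>R x + t *\<^sub>R y"
    have z: "?z \<in> cell {v, w}"
      using xy t convex_cell [of "{v, w}"] unfolding convex_alt by blast
    have "min (x $ v) (y $ v) \<le> ?z $ v"
    proof -
      have "(1 - t) * min (x $ v) (y $ v) + t * min (x $ v) (y $ v) \<le> (1 - t) * x $ v + t * y $ v"
        using t by (intro add_mono mult_left_mono) auto
      then show ?thesis by (simp add: algebra_simps)
    qed
    then have "x $ v \<le> ?z $ v \<or> y $ v \<le> ?z $ v" by linarith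
    then have "u x \<le> u ?z \<or> u y \<le> u ?z" using grow.hyps(4) xy z by blast
    with xy z show "?z \<in> cell {v, w} \<and> c \<le> u ?z" by auto
  qed
  show ?case
  proof (cases "?S = {}")
    case True
    show ?thesis using grow.IH unfolding eq True Un_empty_right .
  next
    case False
    then obtain x where x: "x \<in> cell {v, w}" "c \<le> u x" by blast
    have "x $ v \<le> vertex_point v $ v"
      using x(1) by (rule cell_nth_le)
    then have "u x \<le> u (vertex_point v)" using grow.hyps(4) x by auto
    then have cv: "c \<le> u (vertex_point v)" using x by simp
    have "\<Union>F \<subseteq> V" "r \<in> V" using descending_tree_vertices [OF grow.hyps(1)] by auto
    have "x = vertex_point v" if x: "x \<in> tree_region r F" "x \<in> cell {v, w}" for x
    proof -
      obtain e where e: "x \<in> cell e" "e \<subseteq> V"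
        using x(1) \<open>\<Union>F \<subseteq> V\<close> \<open>r \<in> V\<close> by blast
      then have "x $ w = 0" using grow.hyps(3) unfolding mem_cell_iff by blast
      then show ?thesis using x(2) vw
        by (auto simp: mem_edge_iff vec_eq_iff vertex_point_nth)
    qed
    then have "?T \<inter> ?S = {vertex_point v}"
      using cv descending_tree_vertices(3) [OF grow.hyps(1,2)] by auto
    then have "AR (?T \<inter> ?S)" by (simp add: convex_imp_AR)
    moreover have "AR ?S" using conv False by (rule convex_imp_AR)
    ultimately show ?thesis
      unfolding eq using grow.IH clS AR_closed_Un closed_Un by blast
  qed
qed

lemma unimodal_descending_tree:
  assumes tree: "descending_tree u r V F" and F: "F \<subseteq> E"
    and E: "realization E = (\<Union>e\<in>E. cell e)"
    and cont: "continuous_on UNIV u"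
    and pos: "0 < u (vertex_point r)"
    and nonneg: "\<forall>x\<in>realization E. 0 \<le> u x"
    and zero: "\<forall>e\<in>E - F. \<forall>x\<in>cell e. u x = 0"
  shows "unimodal (top_of_set (realization E)) u"
  unfolding unimodal_def
proof (intro conjI exI [of _ "u (vertex_point r)"] allI impI)
  let ?X = "top_of_set (realization E)"
  have sub: "tree_region r F \<subseteq> realization E"
    using F by (auto simp: realization_cells)
  have super: "superlevel ?X u c = {x \<in> tree_region r F. c \<le> u x}" if "0 < c" for c
  proof -
    have "x \<in> tree_region r F" if "x \<in> realization E" "c \<le> u x" for x
    proof (rule ccontr)
      assume "x \<notin> tree_region r F"
      then have "u x = 0" using that(1) zero unfolding E by blast
      with that(2) \<open>0 < c\<close> show False by simp
    qed
    with sub show ?thesis unfolding superlevel_def topspace_euclidean_subtopology by blast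
  qed
  show "continuous_map ?X (top_of_set {0..}) u"
    using nonneg continuous_on_subset [OF cont subset_UNIV]
    by (simp add: continuous_map_in_subtopology image_subset_iff)
  show "0 < u (vertex_point r)" by (fact pos)
  show "superlevel ?X u c \<noteq> {}" if c: "0 < c \<and> c \<le> u (vertex_point r)" for c
    unfolding super [OF conjunct1 [OF c]] using c by auto
  show "contractible_space (subtopology ?X (superlevel ?X u c))"
    if c: "0 < c \<and> c \<le> u (vertex_point r)" for c
  proof -
    have "contractible (superlevel ?X u c)"
      unfolding super [OF conjunct1 [OF c]]
      using descending_tree_superlevel_AR [OF tree cont] c by (blast intro: AR_imp_contractible)
    moreover have "superlevel ?X u c \<subseteq> realization E" by (auto simp: superlevel_def)
    ultimately show ?thesis
      by (simp add: subtopology_subtopology inf_absorb2)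
  qed
  show "superlevel ?X u c = {}" if c: "u (vertex_point r) < c" for c
  proof -
    have "0 < c" using pos c by simp
    have "u x < c" if "x \<in> tree_region r F" for x
      using descending_tree_le_root [OF tree that] c by simp
    then show ?thesis unfolding super [OF \<open>0 < c\<close>] by fastforce
  qed
qed

section \<open>The circuit through the two long paths\<close>

text \<open>The only circuit of the graph; it runs from \<open>C\<close> along the \<open>D\<close>-path to \<open>Q\<close> and back along the \<open>E\<close>-path.\<close>

definition circuit :: "vertex set set" where
  "circuit = {{C, D1}, {D1, D2}, {D2, D3}, {D3, Q}, {Q, E3}, {E3, E2}, {E2, E1}, {E1, C}}"

lemma circuit_subset_edges: "circuit \<subseteq> edges"
  by (simp add: circuit_def edges_def doubleton_eq_iff)

lemma realization_edges: "realization edges = (\<Union>e\<in>edges. cell e)"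
proof -
  have "\<exists>e\<in>edges. v \<in> e" for v
    by (cases v) (auto simp: edges_def)
  then have "range vertex_point \<subseteq> (\<Union>e\<in>edges. cell e)" by blast
  then show ?thesis unfolding realization_cells by blast
qed

text \<open>
  The eight vertices of the circuit go, in cyclic order, to the corners and side midpoints of the
  square with corners \<open>\<plusminus>1 \<plusminus> i\<close>, and the four arm vertices to the corner assigned to \<open>C\<close>. Every edge
  is mapped into a side of the square, so the interpolated map avoids 0.
\<close>

fun square_position :: "vertex \<Rightarrow> complex" where
  "square_position D1 = Complex 0 (- 1)"
| "square_position D2 = Complex 1 (- 1)"
| "square_position D3 = Complex 1 0"
| "square_position Q = Complex 1 1"
| "square_position E3 = Complex 0 1"
| "square_position E2 = Complex (- 1) 1"
| "square_position E1 = Complex (- 1) 0"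
| "square_position v = Complex (- 1) (- 1)"

lemma square_map_nonzero:
  assumes "x \<in> realization edges"
  shows "extend square_position x \<noteq> 0"
proof -
  from assms obtain e where "e \<in> edges" "x \<in> cell e"
    unfolding realization_edges by blast
  then show ?thesis
    unfolding edges_def
    by (auto simp: extend_edge) (auto simp: mem_edge_iff complex_eq_iff)
qed

lemma linear_comp_linepath:
  assumes "linear L"
  shows "L \<circ> linepath a b = linepath (L a) (L b)"
  by (simp add: fun_eq_iff linepath_def linear_add [OF assms] linear_scale [OF assms])

text \<open>
  A side of the square is the image of two edges of the circuit. Joining at the midpoint reproduces
  the parametrization of the whole side, so the image of the circuit is literally a \<open>rectpath\<close>.
\<close>

lemma linepath_join_midpoint:
  fixes a b :: "'a::real_normed_vector"
  assumes "m = midpoint a b"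
  shows "linepath a m +++ linepath m b = linepath a b"
proof
  fix t :: real
  have "(2 * t) *\<^sub>R m = t *\<^sub>R a + t *\<^sub>R b"
    and "(1 - (2 * t - 1)) *\<^sub>R m = (1 - t) *\<^sub>R a + (1 - t) *\<^sub>R b"
    by (simp_all add: assms midpoint_def scaleR_add_right diff_divide_distrib)
  then have "(1 - 2 * t) *\<^sub>R a + (2 * t) *\<^sub>R m =
      ((1 - 2 * t) *\<^sub>R a + t *\<^sub>R a) + t *\<^sub>R b"
    and "(1 - (2 * t - 1)) *\<^sub>R m + (2 * t - 1) *\<^sub>R b =
      (1 - t) *\<^sub>R a + ((1 - t) *\<^sub>R b + (2 * t - 1) *\<^sub>R b)"
    by (simp_all only: add.assoc)
  moreover have "(1 - 2 * t) *\<^sub>R a + t *\<^sub>R a = (1 - t) *\<^sub>R a"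
    and "(1 - t) *\<^sub>R b + (2 * t - 1) *\<^sub>R b = t *\<^sub>R b"
    by (simp_all flip: scaleR_add_left)
  ultimately show "(linepath a m +++ linepath m b) t = linepath a b t"
    unfolding joinpaths_def linepath_def by simp
qed

text \<open>
  In a contractible \<open>S\<close> the circuit would be null-homotopic, and so would its image in the punctured
  plane, which has winding number 1 around 0.
\<close>

lemma circuit_superset_not_contractible:
  assumes S: "S \<subseteq> realization edges" "(\<Union>e\<in>circuit. cell e) \<subseteq> S"
  shows "\<not> contractible S"
proof
  assume "contractible S"
  let ?L = "extend square_position"
  let ?l = "\<lambda>v w. linepath (vertex_point v) (vertex_point w) :: real \<Rightarrow> real ^ vertex"
  define p where "p = (?l C D1 +++ ?l D1 D2) +++ (?l D2 D3 +++ ?l D3 Q) +++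
    (?l Q E3 +++ ?l E3 E2) +++ (?l E2 E1 +++ ?l E1 C)"
  have seg: "path_image (?l v w) \<subseteq> S" if "{v, w} \<in> circuit" for v w
  proof -
    have "path_image (?l v w) = cell {v, w}"
      by (simp add: cell_def segment_convex_hull)
    with that S(2) show ?thesis by blast
  qed
  have "path_image p \<subseteq> S"
    unfolding p_def by (intro subset_path_image_join seg) (simp_all add: circuit_def)
  moreover have "path p" "pathfinish p = pathstart p"
    by (simp_all add: p_def)
  moreover have "vertex_point C \<in> S"
    using S(2) by (auto simp: circuit_def)
  moreover have "simply_connected S"
    using \<open>contractible S\<close> by (rule contractible_imp_simply_connected)
  ultimately have "homotopic_loops S p (linepath (vertex_point C) (vertex_point C))"
    unfolding simply_connected_eq_contractible_loop_any by blast
  then have "homotopic_loops (- {0}) (?L \<circ> p) (?L \<circ> linepath (vertex_point C) (vertex_point C))"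
    using square_map_nonzero S(1)
    by (intro homotopic_loops_continuous_image continuous_on_extend) auto
  then have "winding_number (?L \<circ> p) 0 =
      winding_number (?L \<circ> linepath (vertex_point C) (vertex_point C)) 0"
    by (rule winding_number_homotopic_loops)
  also have "\<dots> = 0"
    by (simp add: linear_comp_linepath [OF linear_extend] complex_eq_iff)
  also have "?L \<circ> p = rectpath (Complex (- 1) (- 1)) (Complex 1 1)"
    by (simp add: p_def path_compose_join linear_comp_linepath [OF linear_extend]
        linepath_join_midpoint midpoint_def complex_eq_iff rectpath_def Let_def)
  finally show False
    by (simp add: winding_number_rectpath in_box_complex_iff)
qed

text \<open>
  Otherwise the minimum of \<open>u\<close> on the compact circuit would be positive, and the superlevel set at
  that level would be contractible and contain the circuit.
\<close>

lemma unimodal_zero_on_circuit: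
  assumes "unimodal (top_of_set (realization edges)) u"
  obtains x e where "e \<in> circuit" "x \<in> cell e" "u x = 0"
proof -
  let ?K = "\<Union>e\<in>circuit. cell e"
  have sub: "?K \<subseteq> realization edges"
    using circuit_subset_edges by (auto simp: realization_edges)
  have "compact ?K"
    by (intro compact_UN) (auto simp: circuit_def cell_def finite_imp_compact_convex_hull)
  moreover have "vertex_point C \<in> ?K" by (auto simp: circuit_def)
  then have "?K \<noteq> {}" by blast
  moreover have "continuous_on ?K u"
    using unimodal_continuous_on [OF assms] sub by (rule continuous_on_subset)
  ultimately obtain x where x: "x \<in> ?K" and min: "\<And>y. y \<in> ?K \<Longrightarrow> u x \<le> u y"
    using continuous_attains_inf by metis
  have "u x = 0"
  proof (rule ccontr)
    assume "u x \<noteq> 0"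
    then have "0 < u x" using unimodal_nonneg [OF assms, of x] x sub by fastforce
    then have "contractible {y \<in> realization edges. u x \<le> u y}"
      using unimodal_superlevel_contractible [OF assms, of x "u x"] x sub by blast
    moreover have "?K \<subseteq> {y \<in> realization edges. u x \<le> u y}" using min sub by blast
    then have "\<not> contractible {y \<in> realization edges. u x \<le> u y}"
      by (rule circuit_superset_not_contractible [rotated]) (rule Collect_subset)
    ultimately show False by simp
  qed
  moreover obtain e where "e \<in> circuit" "x \<in> cell e" using x by blast
  ultimately show ?thesis using that by simp
qed

section \<open>Three summands are necessary\<close>

text \<open>
  The features of \<open>h = sqrt f\<close> that force a third summand are the strict drops at the ends of the
  arms, which produce two different summands, and the lower bound 1 on the circuit,
  which forces each of the two to reach 1 at \<open>C\<close> if there is no third one.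
\<close>

lemma three_le_unimodal_summands:
  fixes u :: "nat \<Rightarrow> real ^ vertex \<Rightarrow> real"
  assumes uni: "\<And>i. i < n \<Longrightarrow> unimodal (top_of_set (realization edges)) (u i)"
    and h: "\<And>x. x \<in> realization edges \<Longrightarrow> h x = (\<Sum>i<n. u i x)"
    and A: "h (vertex_point A2) < h (vertex_point A1)"
    and B: "h (vertex_point B2) < h (vertex_point B1)"
    and circuit: "\<And>e x. e \<in> circuit \<Longrightarrow> x \<in> cell e \<Longrightarrow> 1 \<le> h x"
    and C: "h (vertex_point C) < 2"
  shows "3 \<le> n"
proof (rule ccontr)
  assume "\<not> 3 \<le> n"
  have mem: "vertex_point v \<in> realization edges" for v
    by (simp add: realization_cells)
  have drop: "\<exists>i<n. u i x < u i y"
    if "h x < h y" "x \<in> realization edges" "y \<in> realization edges" for x y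
  proof (rule ccontr)
    assume "\<not> ?thesis"
    then have "u i y \<le> u i x" if "i < n" for i using that by (meson not_less)
    then have "(\<Sum>i<n. u i y) \<le> (\<Sum>i<n. u i x)" by (intro sum_mono) simp
    with that show False by (simp add: h)
  qed
  obtain i where i: "i < n" "u i (vertex_point A2) < u i (vertex_point A1)"
    using drop [OF A mem mem] by blast
  obtain j where j: "j < n" "u j (vertex_point B2) < u j (vertex_point B1)"
    using drop [OF B mem mem] by blast
  have A2: "u k y \<le> u k (vertex_point A2)"
    if "k < n" "u k (vertex_point A2) < u k (vertex_point A1)" "y \<in> cell e" "e \<in> edges" "A1 \<notin> e"
    for k y e
  proof -
    have "min (u k (vertex_point A1)) (u k y) \<le> u k (vertex_point A2)"
      by (rule unimodal_min_le_cut_vertex [OF uni [OF that(1)] realization_edges,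
            where W = "{A1}" and e = "{A1, A2}" and e' = e])
        (use that(3-5) in \<open>auto simp: edges_def\<close>)
    with that(2) show ?thesis by (simp add: min_def split: if_splits)
  qed
  have B2: "u k y \<le> u k (vertex_point B2)"
    if "k < n" "u k (vertex_point B2) < u k (vertex_point B1)" "y \<in> cell e" "e \<in> edges" "B1 \<notin> e"
    for k y e
  proof -
    have "min (u k (vertex_point B1)) (u k y) \<le> u k (vertex_point B2)"
      by (rule unimodal_min_le_cut_vertex [OF uni [OF that(1)] realization_edges,
            where W = "{B1}" and e = "{B1, B2}" and e' = e])
        (use that(3-5) in \<open>auto simp: edges_def\<close>)
    with that(2) show ?thesis by (simp add: min_def split: if_splits)
  qed
  \<comment> \<open>A common summand would satisfy \<open>u(B1) \<le> u(A2) < u(A1) \<le> u(B2) < u(B1)\<close>.\<close>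
  have "i \<noteq> j"
  proof
    assume "i = j"
    have "u i (vertex_point B1) \<le> u i (vertex_point A2)"
      by (rule A2 [where e = "{B1, B2}"]) (use i in \<open>auto simp: edges_def\<close>)
    moreover have "u i (vertex_point A1) \<le> u i (vertex_point B2)"
      by (rule B2 [where e = "{A1, A2}"]) (use i j \<open>i = j\<close> in \<open>auto simp: edges_def\<close>)
    ultimately show False using i(2) j(2) \<open>i = j\<close> by simp
  qed
  then have "{..<n} = {i, j}"
    using i(1) j(1) \<open>\<not> 3 \<le> n\<close> by auto
  then have sum: "h x = u i x + u j x" if "x \<in> realization edges" for x
    using h [OF that] \<open>i \<noteq> j\<close> by simp
  have ends: "A1 \<notin> e" "A2 \<notin> e" "B1 \<notin> e" "B2 \<notin> e" "e \<in> edges" if "e \<in> circuit" for e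
    using that circuit_subset_edges by (auto simp: circuit_def)
  \<comment> \<open>On the circuit \<open>u i\<close> is at most its value at \<open>A2\<close>, hence smaller than at \<open>A1\<close>, so the minimum
    in the cut vertex inequality at \<open>C\<close> is the value on the circuit.\<close>
  have iC: "u i y \<le> u i (vertex_point C)" if "e \<in> circuit" "y \<in> cell e" for e y
  proof -
    have "min (u i (vertex_point A1)) (u i y) \<le> u i (vertex_point C)"
      by (rule unimodal_min_le_cut_vertex [OF uni [OF i(1)] realization_edges,
            where W = "{A1, A2}" and e = "{A1, A2}" and e' = e])
        (use that ends [OF that(1)] in \<open>auto simp: edges_def\<close>)
    with A2 [OF i that(2)] ends [OF that(1)] i(2) show ?thesis
      by (simp add: min_def split: if_splits)
  qed
  have jC: "u j y \<le> u j (vertex_point C)" if "e \<in> circuit" "y \<in> cell e" for e y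
  proof -
    have "min (u j (vertex_point B1)) (u j y) \<le> u j (vertex_point C)"
      by (rule unimodal_min_le_cut_vertex [OF uni [OF j(1)] realization_edges,
            where W = "{B1, B2}" and e = "{B1, B2}" and e' = e])
        (use that ends [OF that(1)] in \<open>auto simp: edges_def\<close>)
    with B2 [OF j that(2)] ends [OF that(1)] j(2) show ?thesis
      by (simp add: min_def split: if_splits)
  qed
  obtain x e where x: "e \<in> circuit" "x \<in> cell e" "u i x = 0"
    using unimodal_zero_on_circuit [OF uni [OF i(1)]] .
  obtain y e' where y: "e' \<in> circuit" "y \<in> cell e'" "u j y = 0"
    using unimodal_zero_on_circuit [OF uni [OF j(1)]] .
  have "x \<in> realization edges" "y \<in> realization edges"
    using x y circuit_subset_edges by (auto simp: realization_edges)
  then have "1 \<le> u j x" "1 \<le> u i y"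
    using circuit [OF x(1,2)] circuit [OF y(1,2)] x(3) y(3) by (simp_all add: sum)
  then have "2 \<le> h (vertex_point C)"
    using jC [OF x(1,2)] iC [OF y(1,2)] sum [OF mem] by fastforce
  with C show False by simp
qed

section \<open>Powers and sums of unimodal functions\<close>

text \<open>
  The superlevel set of \<open>u powr p\<close> at \<open>c\<close> is the one of \<open>u\<close> at \<open>c powr (1 / p)\<close>.
\<close>

lemma unimodal_powr:
  assumes "unimodal X u" "0 < p"
  shows "unimodal X (\<lambda>x. u x powr p)"
proof -
  obtain M where M: "M > 0" "\<And>c. 0 < c \<Longrightarrow> c \<le> M \<Longrightarrow> superlevel X u c \<noteq> {} \<and>
      contractible_space (subtopology X (superlevel X u c))"
    and empty: "\<And>c. c > M \<Longrightarrow> superlevel X u c = {}"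
    and cont: "continuous_map X (top_of_set {0..}) u"
    using assms(1) unfolding unimodal_def by blast
  have le_iff: "c \<le> t powr p \<longleftrightarrow> c powr (1 / p) \<le> t" if "0 \<le> t" "0 < c" for c t :: real
  proof -
    let ?s = "c powr (1 / p)"
    have "?s powr p = c" using that assms(2) by (simp add: powr_powr)
    moreover have "?s \<le> t \<Longrightarrow> ?s powr p \<le> t powr p"
      using assms(2) by (intro powr_mono2) auto
    moreover have "t < ?s \<Longrightarrow> t powr p < ?s powr p"
      using assms(2) that(1) by (intro powr_less_mono2) auto
    ultimately show ?thesis by linarith
  qed
  have super: "superlevel X (\<lambda>x. u x powr p) c = superlevel X u (c powr (1 / p))" if "0 < c" for c
    using le_iff unimodal_nonneg [OF assms(1)] that by (auto simp: superlevel_def)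
  have "continuous_map (top_of_set {0..}) (top_of_set {0..}) (\<lambda>t::real. t powr p)"
    using assms(2) by (auto simp: continuous_map_in_subtopology
        intro!: continuous_on_powr' [OF continuous_on_id continuous_on_const])
  from continuous_map_compose [OF cont this]
  have "continuous_map X (top_of_set {0..}) (\<lambda>x. u x powr p)"
    by (simp add: o_def)
  moreover have "superlevel X (\<lambda>x. u x powr p) c \<noteq> {} \<and>
      contractible_space (subtopology X (superlevel X (\<lambda>x. u x powr p) c))"
    if "0 < c" "c \<le> M powr p" for c
  proof -
    have "0 < c powr (1 / p)" "c powr (1 / p) \<le> M" using that M(1) le_iff by simp_all
    then show ?thesis unfolding super [OF \<open>0 < c\<close>] by (rule M(2))
  qed
  moreover have "superlevel X (\<lambda>x. u x powr p) c = {}" if "M powr p < c" for c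
  proof -
    have "0 < c" using that powr_ge_zero [of M p] by linarith
    moreover have "M < c powr (1 / p)" using that M(1) le_iff [of M c] \<open>0 < c\<close> by linarith
    ultimately show ?thesis by (simp only: super empty)
  qed
  moreover have "0 < M powr p" using M(1) by simp
  ultimately show ?thesis
    unfolding unimodal_def by blast
qed

lemma ucat_pow_eq_ucat:
  assumes p: "0 < p" and f: "\<And>x. x \<in> topspace X \<Longrightarrow> 0 \<le> f x"
    and g: "\<And>x. x \<in> topspace X \<Longrightarrow> g x = f x powr p"
  shows "ucat_pow p X f = ucat X g"
proof -
  have "(\<exists>u. (\<forall>i<n. unimodal X (u i)) \<and>
        (\<forall>x\<in>topspace X. f x = (\<Sum>i<n. u i x powr p) powr (1 / p))) \<longleftrightarrow>
      (\<exists>u. (\<forall>i<n. unimodal X (u i)) \<and>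
        (\<forall>x\<in>topspace X. g x = (\<Sum>i<n. u i x powr 1) powr (1 / 1)))"
    (is "(\<exists>u. ?P u) \<longleftrightarrow> (\<exists>u. ?Q u)") for n :: nat
  proof
    assume "\<exists>u. ?P u"
    then obtain u where u: "?P u" by blast
    have "g x = (\<Sum>i<n. (u i x powr p) powr 1) powr (1 / 1)" if "x \<in> topspace X" for x
    proof -
      have "f x = (\<Sum>i<n. u i x powr p) powr (1 / p)" using u that by blast
      with p g [OF that] show ?thesis by (simp add: powr_powr sum_nonneg)
    qed
    then show "\<exists>u. ?Q u"
      using u unimodal_powr p by (intro exI [of _ "\<lambda>i x. u i x powr p"]) blast
  next
    assume "\<exists>u. ?Q u"
    then obtain u where u: "?Q u" by blast
    have "f x = (\<Sum>i<n. (u i x powr (1 / p)) powr p) powr (1 / p)" if x: "x \<in> topspace X" for x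
    proof -
      have "u i x powr 1 = (u i x powr (1 / p)) powr p" for i
        using p by (simp add: powr_powr)
      moreover have "g x = (\<Sum>i<n. u i x powr 1) powr (1 / 1)"
        using u x by blast
      ultimately have "g x = (\<Sum>i<n. (u i x powr (1 / p)) powr p)"
        by (simp add: sum_nonneg)
      moreover have "f x = g x powr (1 / p)"
        using g [OF x] f [OF x] p by (simp add: powr_powr)
      ultimately show ?thesis by simp
    qed
    moreover have "\<forall>i<n. unimodal X (\<lambda>x. u i x powr (1 / p))"
    proof -
      have "0 < 1 / p" using p by simp
      with u show ?thesis by (blast intro: unimodal_powr)
    qed
    ultimately show "\<exists>u. ?P u"
      by (intro exI [of _ "\<lambda>i x. u i x powr (1 / p)"]) blast
  qed
  then show ?thesis
    unfolding ucat_def ucat_pow_def by presburger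
qed

lemma ucat_le:
  assumes "\<And>i. i < n \<Longrightarrow> unimodal X (u i)"
    and "\<And>x. x \<in> topspace X \<Longrightarrow> h x = (\<Sum>i<n. u i x)"
  shows "ucat X h \<le> enat n"
proof -
  have "h x = (\<Sum>i<n. u i x powr 1) powr (1 / 1)" if x: "x \<in> topspace X" for x
  proof -
    have "0 \<le> u i x" if "i < n" for i using assms(1) [OF that] x by (rule unimodal_nonneg)
    moreover from this have "0 \<le> (\<Sum>i<n. u i x)" by (intro sum_nonneg) simp
    ultimately show ?thesis using assms(2) [OF x] by simp
  qed
  then show ?thesis
    unfolding ucat_def ucat_pow_def using assms(1) by (intro Inf_lower) blast
qed

lemma le_ucat:
  assumes "\<And>n u. (\<And>i. i < n \<Longrightarrow> unimodal X (u i)) \<Longrightarrow>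
    (\<And>x. x \<in> topspace X \<Longrightarrow> h x = (\<Sum>i<n. u i x)) \<Longrightarrow> m \<le> n"
  shows "enat m \<le> ucat X h"
  unfolding ucat_def ucat_pow_def
proof (rule Inf_greatest, clarify)
  fix n and u :: "nat \<Rightarrow> 'a \<Rightarrow> real"
  assume u: "\<forall>i<n. unimodal X (u i)"
    and h: "\<forall>x\<in>topspace X. h x = (\<Sum>i<n. u i x powr 1) powr (1 / 1)"
  have "h x = (\<Sum>i<n. u i x)" if x: "x \<in> topspace X" for x
  proof -
    have "0 \<le> u i x" if "i < n" for i using u x that by (blast intro: unimodal_nonneg)
    moreover from this have "0 \<le> (\<Sum>i<n. u i x)" by (intro sum_nonneg) simp
    ultimately show ?thesis using bspec [OF h x] by simp
  qed
  then show "enat m \<le> enat n" using assms [of n u] u by simp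
qed

section \<open>Three summands suffice\<close>

text \<open>
  A decomposition of \<open>sqrt f\<close>. The base level 1 is split between \<open>summand_b\<close> and \<open>summand_q\<close>: the
  sums of coordinates in their definitions are complementary and cross over on the edges \<open>C D1\<close> and
  \<open>E2 E3\<close>, so that the circuit is cut open for both. The terms with square roots are the bumps of
  \<open>sqrt f\<close> above 1 at \<open>A1\<close>, \<open>B1\<close>, \<open>C\<close> and \<open>Q\<close>. The bump at \<open>C\<close> goes to \<open>summand_q\<close>, which
  falls from 1 to \<open>sqrt 2 - 1\<close> along \<open>D1 C\<close> and then to 0 along the other three edges at \<open>C\<close>.
\<close>

definition summand_a :: "real ^ vertex \<Rightarrow> real" where
  "summand_a x = sqrt (1 + 4 * x $ A1) - 1"

definition summand_b :: "real ^ vertex \<Rightarrow> real" where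
  "summand_b x = sqrt (1 + 4 * x $ B1) - 1 +
    (x $ A1 + x $ A2 + x $ B1 + x $ B2 + x $ C + x $ E1 + x $ E2)"

definition summand_q :: "real ^ vertex \<Rightarrow> real" where
  "summand_q x = (sqrt (1 + x $ C) - 1) + (sqrt (1 + x $ Q) - 1) +
    (x $ D1 + x $ D2 + x $ D3 + x $ E3 + x $ Q)"

lemma sum_summands:
  assumes "x \<in> realization edges"
  shows "summand_a x + summand_b x + summand_q x =
    sqrt (1 + 4 * x $ A1 + 4 * x $ B1 + x $ C + x $ Q)"
proof -
  from assms obtain e where "e \<in> edges" "x \<in> cell e"
    unfolding realization_edges by blast
  then show ?thesis
    unfolding edges_def summand_a_def summand_b_def summand_q_def
    by (elim insertE emptyE) (simp_all add: mem_edge_iff)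
qed

lemma realization_edges_nonneg: "x \<in> realization edges \<Longrightarrow> 0 \<le> x $ v"
  by (auto simp: realization_edges mem_cell_iff)

lemma unimodal_summand_a: "unimodal (top_of_set (realization edges)) summand_a"
proof (rule unimodal_descending_tree [OF _ _ realization_edges])
  show "descending_tree summand_a A1 {A2, A1} {{A1, A2}}"
    by (rule grow [OF root]) (auto simp: mem_edge_iff summand_a_def)
  show "continuous_on UNIV summand_a"
    unfolding summand_a_def by (intro continuous_intros)
  show "\<forall>x\<in>realization edges. 0 \<le> summand_a x"
    by (auto simp: summand_a_def realization_edges_nonneg)
  show "\<forall>e\<in>edges - {{A1, A2}}. \<forall>x\<in>cell e. summand_a x = 0"
  proof (intro ballI)
    fix e x assume e: "e \<in> edges - {{A1, A2}}" and x: "x \<in> cell e"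
    then have "A1 \<notin> e" by (auto simp: edges_def)
    with x show "summand_a x = 0" by (simp add: mem_cell_iff summand_a_def)
  qed
qed (simp_all add: edges_def summand_a_def vertex_point_nth)

lemma unimodal_summand_b: "unimodal (top_of_set (realization edges)) summand_b"
proof (rule unimodal_descending_tree [OF _ _ realization_edges])
  let ?T = "descending_tree summand_b B1"
  have "?T {B1} {}" by (rule root)
  then have "?T {B2, B1} {{B1, B2}}"
    by (rule grow) (auto simp: mem_edge_iff summand_b_def)
  then have "?T {C, B2, B1} {{B2, C}, {B1, B2}}"
    by (rule grow) (auto simp: mem_edge_iff summand_b_def)
  then have "?T {A2, C, B2, B1} {{C, A2}, {B2, C}, {B1, B2}}"
    by (rule grow) (auto simp: mem_edge_iff summand_b_def)
  then have "?T {A1, A2, C, B2, B1} {{A2, A1}, {C, A2}, {B2, C}, {B1, B2}}"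
    by (rule grow) (auto simp: mem_edge_iff summand_b_def)
  then have "?T {E1, A1, A2, C, B2, B1} {{C, E1}, {A2, A1}, {C, A2}, {B2, C}, {B1, B2}}"
    by (rule grow) (auto simp: mem_edge_iff summand_b_def)
  then have "?T {E2, E1, A1, A2, C, B2, B1}
      {{E1, E2}, {C, E1}, {A2, A1}, {C, A2}, {B2, C}, {B1, B2}}"
    by (rule grow) (auto simp: mem_edge_iff summand_b_def)
  then have "?T {E3, E2, E1, A1, A2, C, B2, B1}
      {{E2, E3}, {E1, E2}, {C, E1}, {A2, A1}, {C, A2}, {B2, C}, {B1, B2}}"
    by (rule grow) (auto simp: mem_edge_iff summand_b_def)
  then show "?T {D1, E3, E2, E1, A1, A2, C, B2, B1}
      {{C, D1}, {E2, E3}, {E1, E2}, {C, E1}, {A2, A1}, {C, A2}, {B2, C}, {B1, B2}}"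
    by (rule grow) (auto simp: mem_edge_iff summand_b_def)
  show "continuous_on UNIV summand_b"
    unfolding summand_b_def by (intro continuous_intros)
  show "\<forall>x\<in>realization edges. 0 \<le> summand_b x"
    unfolding summand_b_def
    by (intro ballI add_nonneg_nonneg) (simp_all add: realization_edges_nonneg)
  let ?F = "{{C, D1}, {E2, E3}, {E1, E2}, {C, E1}, {A2, A1}, {C, A2}, {B2, C}, {B1, B2}}"
  show "?F \<subseteq> edges"
    by (simp add: edges_def doubleton_eq_iff)
  have off: "edges - ?F \<subseteq> {{D1, D2}, {D2, D3}, {D3, Q}, {E3, Q}}"
    unfolding edges_def by (simp add: insert_Diff_if doubleton_eq_iff)
  show "\<forall>e\<in>edges - ?F. \<forall>x\<in>cell e. summand_b x = 0"
  proof (intro ballI)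
    fix e x assume "e \<in> edges - ?F" and x: "x \<in> cell e"
    from subsetD [OF off this(1)] show "summand_b x = 0"
      using x by (elim insertE emptyE) (simp_all add: mem_edge_iff summand_b_def)
  qed
qed (simp add: summand_b_def vertex_point_nth)

text \<open>
  On the edge \<open>D1 C\<close> the function \<open>summand_q\<close> is \<open>sqrt (1 + t) - t\<close> for the coordinate \<open>t\<close> of \<open>C\<close>:
  the growing bump at \<open>C\<close> is outweighed by the loss of the coordinate of \<open>D1\<close>.
\<close>

lemma sqrt_minus_id_antimono:
  fixes a b :: real
  assumes "0 \<le> a" "a \<le> b"
  shows "sqrt (1 + b) - b \<le> sqrt (1 + a) - a"
proof -
  define d where "d = b - a"
  have "1 * d \<le> 2 * sqrt (1 + a) * d"
    using assms real_sqrt_ge_one [of "1 + a"] unfolding d_def by (intro mult_right_mono) linarith+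
  moreover have "(sqrt (1 + a))\<^sup>2 = 1 + a" using assms by simp
  moreover have "0 \<le> d\<^sup>2" by simp
  ultimately have "1 + a + d \<le> (sqrt (1 + a) + d)\<^sup>2"
    unfolding power2_sum by linarith
  then have "sqrt (1 + a + d) \<le> sqrt (1 + a) + d"
    using assms by (intro real_le_lsqrt) (auto simp: d_def)
  then show ?thesis by (simp add: d_def)
qed

lemma unimodal_summand_q: "unimodal (top_of_set (realization edges)) summand_q"
proof (rule unimodal_descending_tree [OF _ _ realization_edges])
  let ?T = "descending_tree summand_q Q"
  have DC: "summand_q x \<le> summand_q y"
    if "x \<in> cell {D1, C}" "y \<in> cell {D1, C}" "x $ D1 \<le> y $ D1" for x y
  proof -
    have "x $ D1 = 1 - x $ C" "y $ D1 = 1 - y $ C" "0 \<le> y $ C"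
      using that by (auto simp: mem_edge_iff)
    then show ?thesis
      using that sqrt_minus_id_antimono [of "y $ C" "x $ C"]
      by (simp add: mem_edge_iff summand_q_def)
  qed
  have Q: "summand_q x \<le> summand_q y"
    if "x \<in> cell {Q, v}" "y \<in> cell {Q, v}" "x $ Q \<le> y $ Q" "v = E3 \<or> v = D3" for x y v
  proof -
    have "x $ v = 1 - x $ Q" "y $ v = 1 - y $ Q" "sqrt (1 + x $ Q) \<le> sqrt (1 + y $ Q)"
      using that by (auto simp: mem_edge_iff)
    then show ?thesis
      using that by (auto simp: mem_edge_iff summand_q_def)
  qed
  have "?T {Q} {}" by (rule root)
  then have "?T {E3, Q} {{Q, E3}}"
    by (rule grow) (auto intro: Q)
  then have "?T {E2, E3, Q} {{E3, E2}, {Q, E3}}"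
    by (rule grow) (auto simp: mem_edge_iff summand_q_def)
  then have "?T {D3, E2, E3, Q} {{Q, D3}, {E3, E2}, {Q, E3}}"
    by (rule grow) (auto intro: Q)
  then have "?T {D2, D3, E2, E3, Q} {{D3, D2}, {Q, D3}, {E3, E2}, {Q, E3}}"
    by (rule grow) (auto simp: mem_edge_iff summand_q_def)
  then have "?T {D1, D2, D3, E2, E3, Q} {{D2, D1}, {D3, D2}, {Q, D3}, {E3, E2}, {Q, E3}}"
    by (rule grow) (auto simp: mem_edge_iff summand_q_def)
  then have "?T {C, D1, D2, D3, E2, E3, Q}
      {{D1, C}, {D2, D1}, {D3, D2}, {Q, D3}, {E3, E2}, {Q, E3}}"
    by (rule grow) (auto simp: DC)
  then have "?T {A2, C, D1, D2, D3, E2, E3, Q}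
      {{C, A2}, {D1, C}, {D2, D1}, {D3, D2}, {Q, D3}, {E3, E2}, {Q, E3}}"
    by (rule grow) (auto simp: mem_edge_iff summand_q_def)
  then have "?T {B2, A2, C, D1, D2, D3, E2, E3, Q}
      {{C, B2}, {C, A2}, {D1, C}, {D2, D1}, {D3, D2}, {Q, D3}, {E3, E2}, {Q, E3}}"
    by (rule grow) (auto simp: mem_edge_iff summand_q_def)
  then show "?T {E1, B2, A2, C, D1, D2, D3, E2, E3, Q}
      {{C, E1}, {C, B2}, {C, A2}, {D1, C}, {D2, D1}, {D3, D2}, {Q, D3}, {E3, E2}, {Q, E3}}"
    by (rule grow) (auto simp: mem_edge_iff summand_q_def)
  show "continuous_on UNIV summand_q"
    unfolding summand_q_def by (intro continuous_intros)
  show "\<forall>x\<in>realization edges. 0 \<le> summand_q x"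
    unfolding summand_q_def
    by (intro ballI add_nonneg_nonneg) (simp_all add: realization_edges_nonneg)
  let ?F = "{{C, E1}, {C, B2}, {C, A2}, {D1, C}, {D2, D1}, {D3, D2}, {Q, D3}, {E3, E2}, {Q, E3}}"
  show "?F \<subseteq> edges"
    by (simp add: edges_def doubleton_eq_iff)
  have off: "edges - ?F \<subseteq> {{A1, A2}, {B1, B2}, {E1, E2}}"
    unfolding edges_def by (simp add: insert_Diff_if doubleton_eq_iff)
  show "\<forall>e\<in>edges - ?F. \<forall>x\<in>cell e. summand_q x = 0"
  proof (intro ballI)
    fix e x assume "e \<in> edges - ?F" and x: "x \<in> cell e"
    from subsetD [OF off this(1)] show "summand_q x = 0"
      using x by (elim insertE emptyE) (simp_all add: mem_edge_iff summand_q_def)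
  qed
qed (simp add: summand_q_def vertex_point_nth)

section \<open>The unimodal category of the square root\<close>

theorem proposition4p8:
  fixes X :: "(real ^ vertex) topology" and f :: "real ^ vertex \<Rightarrow> real"
  assumes X_def: "X = top_of_set (realization edges)"
    and linear: "linear_on_edges edges f"
    and f_5: "\<forall>v\<in>{A1, B1}. f (vertex_point v) = 5"
    and f_2: "\<forall>v\<in>{C, Q}. f (vertex_point v) = 2"
    and f_1: "\<forall>v\<in>{A2, B2, D1, D2, D3, E1, E2, E3}. f (vertex_point v) = 1"
  shows "ucat_pow (1 / 2) X f = ucat X (\<lambda>x. sqrt (f x)) \<and> ucat X (\<lambda>x. sqrt (f x)) = 3"
proof
  have f: "f x = 1 + 4 * x $ A1 + 4 * x $ B1 + x $ C + x $ Q"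
    if x: "x \<in> realization edges" for x
  proof -
    obtain e where e: "e \<in> edges" "x \<in> cell e"
      using x unfolding realization_edges by blast
    have "\<forall>e\<in>edges. card e = 2" by (simp add: edges_def)
    then have "card e = 2" using e(1) by (rule bspec)
    then obtain v w where "e = {v, w}" "v \<noteq> w"
      unfolding card_2_iff by blast
    with e have vw: "{v, w} \<in> edges" "v \<noteq> w" "x \<in> cell {v, w}" by simp_all
    have "f x = extend (\<lambda>z. f (vertex_point z)) x"
      using linear_on_edges_extend [OF linear vw] .
    moreover have "(\<Sum>z\<in>UNIV. x $ z) = 1"
      using vw(3) by (simp add: mem_cell_iff)
    ultimately show ?thesis
      using f_1 f_2 f_5 by (simp add: extend_def UNIV_vertex)
  qed
  have ge: "1 \<le> f x" if "x \<in> realization edges" for x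
    using realization_edges_nonneg [OF that] by (simp add: f [OF that])
  show "ucat_pow (1 / 2) X f = ucat X (\<lambda>x. sqrt (f x))"
  proof (rule ucat_pow_eq_ucat)
    fix x assume "x \<in> topspace X"
    then have "1 \<le> f x" using ge by (simp add: X_def)
    then show "0 \<le> f x" "sqrt (f x) = f x powr (1 / 2)" by (simp_all add: powr_half_sqrt)
  qed simp
  have "ucat X (\<lambda>x. sqrt (f x)) \<le> enat 3"
  proof (rule ucat_le [where u = "\<lambda>i. [summand_a, summand_b, summand_q] ! i"])
    show "unimodal X ([summand_a, summand_b, summand_q] ! i)" if "i < 3" for i
      using that unimodal_summand_a unimodal_summand_b unimodal_summand_q
      by (auto simp: X_def less_Suc_eq numeral_3_eq_3)
    show "sqrt (f x) = (\<Sum>i<3. ([summand_a, summand_b, summand_q] ! i) x)"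
      if "x \<in> topspace X" for x
      using that f [of x] sum_summands [of x] by (simp add: X_def numeral_3_eq_3)
  qed
  moreover have "enat 3 \<le> ucat X (\<lambda>x. sqrt (f x))"
  proof (rule le_ucat)
    fix n and u :: "nat \<Rightarrow> real ^ vertex \<Rightarrow> real"
    assume u: "\<And>i. i < n \<Longrightarrow> unimodal X (u i)"
      and sum: "\<And>x. x \<in> topspace X \<Longrightarrow> sqrt (f x) = (\<Sum>i<n. u i x)"
    show "3 \<le> n"
    proof (rule three_le_unimodal_summands)
      show "1 \<le> sqrt (f x)" if "e \<in> circuit" "x \<in> cell e" for e x
      proof -
        have "x \<in> realization edges"
          using that circuit_subset_edges by (auto simp: realization_edges)
        then show ?thesis using ge by simp
      qed
      have "sqrt 2 < sqrt (2\<^sup>2)" by (simp only: real_sqrt_less_iff) simp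
      then show "sqrt (f (vertex_point C)) < 2" using f_2 by simp
    qed (use u sum f_1 f_5 in \<open>auto simp: X_def\<close>)
  qed
  ultimately show "ucat X (\<lambda>x. sqrt (f x)) = 3"
    by (simp add: numeral_eq_enat antisym)
qed

end
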